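(* The number $\zeta(3)=\sum_{n=1}^{\infty}\frac{1}{n^3}$ is irrational.
   Context: For real $s>1$, $\zeta(s):=\sum_{n=1}^{\infty} 1/n^s$ is the Riemann zeta function. *)

theory Defs
  imports Complex_Main
begin

text \<open>
  The Riemann zeta function on the real half-line \<open>s > 1\<close>. The summation index is shifted by one
  because series are indexed from \<open>0\<close>. For \<open>s \<le> 1\<close> the series diverges and the value is a
  meaningless default.
\<close>

definition zeta :: "real \<Rightarrow> real" where
  "zeta s = (\<Sum>n. 1 / real (Suc n) powr s)"

end

theory Submission
  imports Defs "HOL-Computational_Algebra.Primes" "HOL-Analysis.Summation_Tests"
begin

text \<open>
  This is Apery's proof. The integers \<open>a\<^sub>n = \<Sum>k\<le>n. (n choose k)\<^sup>2 (n + k choose k)\<^sup>2\<close> and the rational numbers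
  \<open>b\<^sub>n\<close>, in which the same summands are weighted by numbers \<open>c\<^sub>n\<^sub>,\<^sub>k\<close> close to the \<open>n\<close>-th partial sum of
  \<open>\<zeta>(3)\<close>, satisfy one and the same three-term recurrence (\<open>apery_a_recurrence\<close>, \<open>apery_b_recurrence\<close>).
  A recurrence with two solutions makes their Casoratian computable: here
  \<open>b\<^sub>n\<^sub>+\<^sub>1 a\<^sub>n - a\<^sub>n\<^sub>+\<^sub>1 b\<^sub>n = 6 / (n + 1)\<^sup>3\<close> (\<open>apery_casoratian\<close>). So \<open>b\<^sub>n / a\<^sub>n\<close> increases, its limit is \<open>\<zeta>(3)\<close>,
  and summing the increments gives \<open>0 < a\<^sub>n \<zeta>(3) - b\<^sub>n \<le> 6 \<zeta>(3) / a\<^sub>n\<close> (\<open>apery_remainder_pos\<close>,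
  \<open>apery_remainder_le\<close>). The recurrence also makes \<open>a\<^sub>n\<close> grow by a factor of at least \<open>32\<close> in each late step
  (\<open>apery_a_growth\<close>).

  On the arithmetic side, \<open>2 lcm(1,\<dots>,n)\<^sup>3 b\<^sub>n\<close> is an integer (\<open>apery_b_denominator\<close>), and
  \<open>lcm(1,\<dots>,n) = O(3.1\<^sup>n)\<close> (\<open>lcm_upto_bound\<close>). If \<open>\<zeta>(3) = p / q\<close>, then \<open>2 q lcm(1,\<dots>,n)\<^sup>3 (a\<^sub>n \<zeta>(3) - b\<^sub>n)\<close> is
  a positive integer that is \<open>O((3.1\<^sup>3 / 32)\<^sup>n)\<close>, which is absurd because \<open>3.1\<^sup>3 = 29.791 < 32\<close>.

  Two points carry the technical weight. The recurrences are proved by creative telescoping: applied to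
  the summands, the recurrence operator gives a difference in \<open>k\<close> of an explicit expression (\<open>telescoper_a\<close>,
  \<open>telescoper_b\<close>), so the sum over \<open>k\<close> vanishes. The bound on the least common multiple is of Chebyshev type,
  and it must be sharper than \<open>33.97\<^sup>1\<^sup>/\<^sup>3 \<approx> 3.24\<close>, where \<open>33.97 \<approx> (1 + sqrt 2)\<^sup>4\<close> is the true growth rate
  of \<open>a\<^sub>n\<close>. It comes from \<open>1/2 + 1/3 + 1/7 + 1/42 = 1\<close>: the almost multinomial number
  \<open>n! / ((n div 2)! (n div 3)! (n div 7)! (n div 42)!)\<close> contains each prime \<open>p\<close> at least as often as there are
  powers of \<open>p\<close> between \<open>n div 42\<close> and \<open>n\<close>, so that its product with \<open>lcm(1,\<dots>,n div 42)\<close> is a multiple of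
  \<open>lcm(1,\<dots>,n)\<close>, and the multinomial theorem bounds it (\<open>lcm_upto_dvd\<close>, \<open>fact_quotient_bound\<close>).
\<close>

section \<open>Products of binomial coefficients\<close>

text \<open>
  Up to the sign \<open>(-1)\<^sup>k\<close>, these are the coefficients of the shifted Legendre polynomials.
\<close>

definition legendre_coeff :: "nat \<Rightarrow> nat \<Rightarrow> nat" where
  "legendre_coeff n k = (n choose k) * ((n + k) choose k)"

text \<open>
  Apery's weights. For \<open>k > n\<close> the second sum contains quotients by \<open>0\<close>, which have the value \<open>0\<close>; such a weight
  contributes only with the factor \<open>legendre_coeff n k = 0\<close>.
\<close>

definition apery_c :: "nat \<Rightarrow> nat \<Rightarrow> real" where
  "apery_c n k = (\<Sum>m=1..n. 1 / real m ^ 3)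
      + (\<Sum>m=1..k. (-1) ^ (m + 1) / (2 * real m ^ 3 * real (legendre_coeff n m)))"

lemma legendre_coeff_0_right[simp]: "legendre_coeff n 0 = 1" by (simp add: legendre_coeff_def)

lemma legendre_coeff_eq_0: "n < k \<Longrightarrow> legendre_coeff n k = 0" by (simp add: legendre_coeff_def)

lemma legendre_coeff_pos: "k \<le> n \<Longrightarrow> 0 < legendre_coeff n k" by (simp add: legendre_coeff_def)

lemma legendre_coeff_fact:
  assumes "k \<le> n"
  shows "real (legendre_coeff n k) * fact (n - k) * fact k ^ 2 = fact (n + k)"
proof -
  have "fact k * fact (n - k) * (n choose k) = (fact n :: nat)"
    by (rule binomial_fact_lemma[OF assms])
  moreover have "fact k * fact n * ((n + k) choose k) = (fact (n + k) :: nat)"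
    using binomial_fact_lemma[of k "n + k"] by simp
  ultimately have "legendre_coeff n k * fact (n - k) * fact k ^ 2 = (fact (n + k) :: nat)"
    unfolding legendre_coeff_def power2_eq_square by (metis mult.assoc mult.commute)
  from arg_cong[OF this, of real] show ?thesis by simp
qed

lemma legendre_coeff_Suc_left:
  assumes "k \<le> n"
  shows "(real n + 1 - real k) * real (legendre_coeff (Suc n) k)
      = (real n + 1 + real k) * real (legendre_coeff n k)"
proof -
  have "real (legendre_coeff (Suc n) k) * fact (Suc n - k) * fact k ^ 2 = fact (Suc (n + k))"
    using legendre_coeff_fact[of k "Suc n"] assms by simp
  also have "fact (Suc (n + k))
      = (real n + 1 + real k) * (real (legendre_coeff n k) * fact (n - k) * fact k ^ 2)"
    using legendre_coeff_fact[OF assms] by (simp add: algebra_simps)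
  also have "fact (Suc n - k) = (real n + 1 - real k) * fact (n - k)"
    using assms by (simp add: Suc_diff_le of_nat_diff algebra_simps)
  finally have "((real n + 1 - real k) * real (legendre_coeff (Suc n) k))
      * (fact (n - k) * fact k ^ 2)
     = ((real n + 1 + real k) * real (legendre_coeff n k)) * (fact (n - k) * fact k ^ 2)"
    by (simp add: mult_ac)
  thus ?thesis by simp
qed

lemma legendre_coeff_Suc_right:
  "(real k + 1)\<^sup>2 * real (legendre_coeff n (Suc k))
      = (real n + real k + 1) * (real n - real k) * real (legendre_coeff n k)"
proof (cases "k < n")
  case True
  have "real (legendre_coeff n (Suc k)) * fact (n - Suc k) * fact (Suc k) ^ 2 = fact (Suc (n + k))"
    using legendre_coeff_fact[of "Suc k" n] True by simp
  also have "fact (Suc (n + k))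
      = (real n + real k + 1) * (real (legendre_coeff n k) * fact (n - k) * fact k ^ 2)"
    using legendre_coeff_fact[of k n] True by (simp add: algebra_simps)
  also have "fact (n - k) = (real n - real k) * fact (n - Suc k)"
    using True by (metis Suc_diff_Suc fact_Suc of_nat_diff less_imp_le)
  finally have "((real k + 1)\<^sup>2 * real (legendre_coeff n (Suc k))) * (fact (n - Suc k) * fact k ^ 2)
     = ((real n + real k + 1) * (real n - real k) * real (legendre_coeff n k))
         * (fact (n - Suc k) * fact k ^ 2)"
    by (simp add: mult_ac add_ac power_mult_distrib power2_eq_square)
  thus ?thesis by simp
next
  case False
  thus ?thesis by (cases "k = n") (auto simp: legendre_coeff_eq_0)
qed

text \<open>
  All four neighbouring values that occur in the telescoping identities are polynomial multiples of one
  number, \<open>s = (n + k + 1)! / ((n + 1 - k)! ((k + 1)!)\<^sup>2)\<close>. This includes the boundary, where some of the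
  binomial coefficients are \<open>0\<close> and ratios of neighbours are meaningless: the factors \<open>n + 1 - k\<close> and \<open>n - k\<close>
  vanish exactly there.
\<close>

lemma legendre_coeff_common_factor:
  fixes n k :: nat
  assumes "k \<le> Suc n"
  obtains s where
    "real (legendre_coeff (Suc n) k) = s * (real k + 1)\<^sup>2"
    "real (legendre_coeff (Suc n) (Suc k)) = s * (real n + real k + 2) * (real n + 1 - real k)"
    "real (legendre_coeff (Suc (Suc n)) (Suc k)) = s * (real n + real k + 2) * (real n + real k + 3)"
    "real (legendre_coeff n (Suc k)) = s * (real n + 1 - real k) * (real n - real k)"
proof -
  define s where "s = real (legendre_coeff (Suc n) k) / (real k + 1)\<^sup>2"
  have nz: "(real k + 1)\<^sup>2 \<noteq> 0" by (simp add: add_nonneg_eq_0_iff)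
  have 1: "real (legendre_coeff (Suc n) k) = s * (real k + 1)\<^sup>2" using nz by (simp add: s_def)
  have 2: "real (legendre_coeff (Suc n) (Suc k)) = s * (real n + real k + 2) * (real n + 1 - real k)"
  proof -
    have "(real k + 1)\<^sup>2 * real (legendre_coeff (Suc n) (Suc k))
        = (real k + 1)\<^sup>2 * (s * (real n + real k + 2) * (real n + 1 - real k))"
      using legendre_coeff_Suc_right[of k "Suc n"] unfolding 1 by (simp add: mult_ac add_ac)
    thus ?thesis using nz by simp
  qed
  have 3: "real (legendre_coeff (Suc (Suc n)) (Suc k))
      = s * (real n + real k + 2) * (real n + real k + 3)"
  proof -
    have eq: "(real k + 1)\<^sup>2 * real (legendre_coeff (Suc (Suc n)) (Suc k))
       = (real n + real k + 3) * (real n + 2 - real k) * real (legendre_coeff (Suc (Suc n)) k)"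
      using legendre_coeff_Suc_right[of k "Suc (Suc n)"] by (simp add: add_ac)
    have "(real n + 2 - real k) * ((real k + 1)\<^sup>2 * real (legendre_coeff (Suc (Suc n)) (Suc k)))
       = (real n + real k + 3) * (real n + 2 - real k)
           * ((real n + 2 - real k) * real (legendre_coeff (Suc (Suc n)) k))"
      unfolding eq by (simp add: mult_ac)
    also have "(real n + 2 - real k) * real (legendre_coeff (Suc (Suc n)) k)
        = (real n + 2 + real k) * real (legendre_coeff (Suc n) k)"
      using legendre_coeff_Suc_left[of k "Suc n"] assms by (simp add: algebra_simps)
    finally have "(real n + 2 - real k) * (real k + 1)\<^sup>2 * real (legendre_coeff (Suc (Suc n)) (Suc k))
       = (real n + 2 - real k) * (real k + 1)\<^sup>2 * (s * (real n + real k + 2) * (real n + real k + 3))"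
      unfolding 1 by (simp add: mult_ac add_ac)
    moreover have "real n + 2 - real k \<noteq> 0" using assms by linarith
    ultimately show ?thesis using nz by simp
  qed
  have 4: "real (legendre_coeff n (Suc k)) = s * (real n + 1 - real k) * (real n - real k)"
  proof (cases "Suc k \<le> n")
    case True
    have "(real n + real k + 2) * real (legendre_coeff n (Suc k))
        = (real n + real k + 2) * (s * (real n + 1 - real k) * (real n - real k))"
      using legendre_coeff_Suc_left[OF True] unfolding 2 by (simp add: algebra_simps)
    moreover have "real n + real k + 2 \<noteq> 0" by linarith
    ultimately show ?thesis by simp
  next
    case False
    hence "k = n \<or> k = Suc n" using assms by linarith
    thus ?thesis by (auto simp: legendre_coeff_eq_0)
  qed
  show ?thesis by (rule that[OF 1 2 3 4])
qed

section \<open>The recurrence, by creative telescoping\<close>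

text \<open>
  The recurrence is \<open>(x + 1)\<^sup>3 u\<^sub>x\<^sub>+\<^sub>1 - apery_poly x \<cdot> u\<^sub>x + x\<^sup>3 u\<^sub>x\<^sub>-\<^sub>1 = 0\<close>. Below it is always used at \<open>x = n + 1\<close>, so
  that no predecessors occur.
\<close>

definition apery_poly :: "real \<Rightarrow> real" where "apery_poly x = 34 * x ^ 3 + 51 * x ^ 2 + 27 * x + 5"

text \<open>
  Zagier's certificate for the sequence \<open>a\<close>.
\<close>

definition telescoper_a :: "nat \<Rightarrow> nat \<Rightarrow> real" where
  "telescoper_a n k = 4 * (2 * real n + 1) * (real k * (2 * real k + 1) - (2 * real n + 1)\<^sup>2)
      * real (legendre_coeff n k) ^ 2"

text \<open>
  Divided by the square of the common factor \<open>s\<close>, this is a polynomial identity in \<open>n\<close> and \<open>k\<close>.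
\<close>

lemma telescoper_a_diff:
  assumes "k \<le> Suc n"
  shows "telescoper_a (Suc n) (Suc k) - telescoper_a (Suc n) k =
    (real n + 2) ^ 3 * real (legendre_coeff (Suc (Suc n)) (Suc k)) ^ 2
        - apery_poly (real n + 1) * real (legendre_coeff (Suc n) (Suc k)) ^ 2
    + (real n + 1) ^ 3 * real (legendre_coeff n (Suc k)) ^ 2"
proof -
  obtain s where s:
    "real (legendre_coeff (Suc n) k) = s * (real k + 1)\<^sup>2"
    "real (legendre_coeff (Suc n) (Suc k)) = s * (real n + real k + 2) * (real n + 1 - real k)"
    "real (legendre_coeff (Suc (Suc n)) (Suc k)) = s * (real n + real k + 2) * (real n + real k + 3)"
    "real (legendre_coeff n (Suc k)) = s * (real n + 1 - real k) * (real n - real k)"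
    using legendre_coeff_common_factor[OF assms] by blast
  show ?thesis unfolding telescoper_a_def apery_poly_def s of_nat_Suc by algebra
qed

text \<open>
  The summands of \<open>c\<^sub>n\<^sub>,\<^sub>k\<close> are chosen such that this difference has a closed form. It is what makes the weights
  compatible with the recurrence: the difference is \<open>1 / legendre_coeff n k\<close> times a rational function, so it
  cancels one factor of the squared summand.
\<close>

lemma apery_c_diff_left:
  assumes "k \<le> n"
  shows "apery_c (Suc n) k - apery_c n k
      = (-1) ^ k / ((real n + 1)\<^sup>2 * (real n + 1 + real k) * real (legendre_coeff n k))"
  using assms
proof (induction k)
  case 0
  show ?case by (simp add: apery_c_def power2_eq_square power3_eq_cube add_ac)
next
  case (Suc k)
  define q where "q = real (legendre_coeff n k)"
  define N where "N = real n"
  define K where "K = real k"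
  have KN: "K + 1 \<le> N" "K \<ge> 0" using Suc.prems by (auto simp: K_def N_def)
  have q: "q > 0" using Suc.prems by (simp add: q_def legendre_coeff_pos)
  have t1: "real (legendre_coeff n (Suc k)) = q * (N + K + 1) * (N - K) / (K + 1)\<^sup>2"
    using legendre_coeff_Suc_right[of k n] KN by (simp add: q_def N_def K_def field_simps)
  have "(N - K) * real (legendre_coeff (Suc n) (Suc k))
      = (N + K + 2) * real (legendre_coeff n (Suc k))"
    using legendre_coeff_Suc_left[of "Suc k" n] Suc.prems by (simp add: N_def K_def algebra_simps)
  hence "(N - K) * real (legendre_coeff (Suc n) (Suc k))
      = (N - K) * (q * (N + K + 1) * (N + K + 2) / (K + 1)\<^sup>2)"
    unfolding t1 by (simp add: mult_ac)
  hence t2: "real (legendre_coeff (Suc n) (Suc k)) = q * (N + K + 1) * (N + K + 2) / (K + 1)\<^sup>2"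
    using KN by (simp only: mult_cancel_left) linarith
  have "apery_c (Suc n) (Suc k) - apery_c n (Suc k) = (apery_c (Suc n) k - apery_c n k)
     + (-1) ^ k / (2 * (K + 1) ^ 3 * real (legendre_coeff (Suc n) (Suc k)))
     - (-1) ^ k / (2 * (K + 1) ^ 3 * real (legendre_coeff n (Suc k)))"
    by (simp add: apery_c_def K_def add_ac)
  also have "apery_c (Suc n) k - apery_c n k = (-1) ^ k / ((N + 1)\<^sup>2 * (N + 1 + K) * q)"
    using Suc by (simp add: N_def K_def q_def)
  also have "(-1) ^ k / ((N + 1)\<^sup>2 * (N + 1 + K) * q)
     + (-1) ^ k / (2 * (K + 1) ^ 3 * real (legendre_coeff (Suc n) (Suc k)))
     - (-1) ^ k / (2 * (K + 1) ^ 3 * real (legendre_coeff n (Suc k)))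
   = (-1) ^ Suc k / ((N + 1)\<^sup>2 * (N + 1 + (K + 1)) * real (legendre_coeff n (Suc k)))"
  proof -
    have [simp]: "N + K + 1 \<noteq> 0" "N + 1 + K \<noteq> 0" "N + K + 2 \<noteq> 0" "N + 1 + (K + 1) \<noteq> 0"
       "N - K \<noteq> 0" "N \<noteq> K" "2 + (N + K) \<noteq> 0" "2 * K + 2 \<noteq> 0" "K + 1 \<noteq> 0" "N + 1 \<noteq> 0" "q \<noteq> 0"
      using KN q by auto
    define \<sigma> where "\<sigma> = (-1 :: real) ^ k"
    have "\<sigma> / ((N + 1)\<^sup>2 * (N + 1 + K) * q)
     + \<sigma> / (2 * (K + 1) ^ 3 * (q * (N + K + 1) * (N + K + 2) / (K + 1)\<^sup>2))
     - \<sigma> / (2 * (K + 1) ^ 3 * (q * (N + K + 1) * (N - K) / (K + 1)\<^sup>2))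
     = (- \<sigma>) / ((N + 1)\<^sup>2 * (N + 1 + (K + 1)) * (q * (N + K + 1) * (N - K) / (K + 1)\<^sup>2))"
      by (simp add: divide_simps) algebra
    thus ?thesis unfolding t1 t2 \<sigma>_def by simp
  qed
  finally show ?case by (simp add: N_def K_def add_ac)
qed

lemma apery_c_Suc_right:
  "apery_c n (Suc k) = apery_c n k
      + (-1) ^ k / (2 * (real k + 1) ^ 3 * real (legendre_coeff n (Suc k)))"
  by (simp add: apery_c_def add_ac)

text \<open>
  If the weights were constant, the first summand would be enough. The differences of the weights in \<open>n\<close> and
  in \<open>k\<close> leave a remainder, and this remainder is itself the difference in \<open>k\<close> of the second summand.
\<close>

definition telescoper_b :: "nat \<Rightarrow> nat \<Rightarrow> real" where
  "telescoper_b n k = telescoper_a n k * apery_c n k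
     - (-1) ^ k * 5 * (2 * real n + 1) * real k / (real n * (real n + 1)) * real (legendre_coeff n k)"

text \<open>
  Every weight is expressed by a single one (\<open>y\<close> or \<open>x\<close> in the proof) and a closed form. The coefficients of
  that weight agree by \<open>telescoper_a_diff\<close>; what remains is an identity of rational functions. At
  \<open>k = n + 1\<close> the last two terms vanish and \<open>apery_c_diff_left\<close> is not applicable to \<open>c\<^sub>n\<^sub>+\<^sub>1\<^sub>,\<^sub>k\<^sub>+\<^sub>1\<close>, so that all weights
  are compared with \<open>c\<^sub>n\<^sub>+\<^sub>1\<^sub>,\<^sub>n\<^sub>+\<^sub>1\<close> instead.
\<close>

lemma telescoper_b_diff:
  assumes "k \<le> Suc n"
  shows "telescoper_b (Suc n) (Suc k) - telescoper_b (Suc n) k =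
    (real n + 2) ^ 3 * (real (legendre_coeff (Suc (Suc n)) (Suc k)) ^ 2
        * apery_c (Suc (Suc n)) (Suc k))
    - apery_poly (real n + 1) * (real (legendre_coeff (Suc n) (Suc k)) ^ 2 * apery_c (Suc n) (Suc k))
    + (real n + 1) ^ 3 * (real (legendre_coeff n (Suc k)) ^ 2 * apery_c n (Suc k))"
proof -
  obtain s where s:
    "real (legendre_coeff (Suc n) k) = s * (real k + 1)\<^sup>2"
    "real (legendre_coeff (Suc n) (Suc k)) = s * (real n + real k + 2) * (real n + 1 - real k)"
    "real (legendre_coeff (Suc (Suc n)) (Suc k)) = s * (real n + real k + 2) * (real n + real k + 3)"
    "real (legendre_coeff n (Suc k)) = s * (real n + 1 - real k) * (real n - real k)"
    using legendre_coeff_common_factor[OF assms] by blast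
  have s0: "s \<noteq> 0"
    using s(1) legendre_coeff_pos[OF assms] by auto
  define N where "N = real n"
  define K where "K = real k"
  have NK: "N \<ge> 0" "K \<ge> 0" by (auto simp: N_def K_def)
  define \<sigma> where "\<sigma> = (-1 :: real) ^ k"
  define x where "x = apery_c (Suc n) k"
  note s' = s[folded N_def K_def]
  show ?thesis
  proof (cases "k \<le> n")
    case True
    hence D: "N + 1 - K \<noteq> 0" by (auto simp: N_def K_def)
    define y where "y = apery_c (Suc n) (Suc k)"
    have xy: "x = y - \<sigma> / (2 * (K + 1) ^ 3 * real (legendre_coeff (Suc n) (Suc k)))"
      using apery_c_Suc_right[of "Suc n" k] by (simp add: x_def y_def \<sigma>_def K_def)
    have y1: "apery_c (Suc (Suc n)) (Suc k)
        = y - \<sigma> / ((N + 2)\<^sup>2 * (N + K + 3) * real (legendre_coeff (Suc n) (Suc k)))"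
      using apery_c_diff_left[of "Suc k" "Suc n"] True by (simp add: y_def \<sigma>_def N_def K_def add_ac)
    \<comment> \<open>The closed form fails at \<open>k = n\<close>, but there the factor \<open>legendre_coeff n (Suc k)\<close> is \<open>0\<close>.\<close>
    have y0: "real (legendre_coeff n (Suc k)) ^ 2 * apery_c n (Suc k) =
      real (legendre_coeff n (Suc k)) ^ 2 * y
          + \<sigma> / ((N + 1)\<^sup>2 * (N + K + 2)) * real (legendre_coeff n (Suc k))"
    proof (cases "k = n")
      case False
      hence "apery_c n (Suc k) = y + \<sigma> / ((N + 1)\<^sup>2 * (N + K + 2) * real (legendre_coeff n (Suc k)))"
        using apery_c_diff_left[of "Suc k" n] True by (simp add: y_def \<sigma>_def N_def K_def add_ac)
      thus ?thesis by (simp add: power2_eq_square distrib_left)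
    qed (auto simp: legendre_coeff_eq_0)
    have nz: "N + K + 2 \<noteq> 0" "N + K + 3 \<noteq> 0" "K + 1 \<noteq> 0" "N + 1 \<noteq> 0" "N + 2 \<noteq> 0" "N + 1 + 1 \<noteq> 0"
      using NK by auto
    have "telescoper_b (Suc n) (Suc k) - telescoper_b (Suc n) k
        = (telescoper_a (Suc n) (Suc k) - telescoper_a (Suc n) k) * y
       + (telescoper_a (Suc n) k * (\<sigma> / (2 * (K + 1) ^ 3 * real (legendre_coeff (Suc n) (Suc k))))
       + \<sigma> * 5 * (2 * N + 3) * (K + 1) / ((N + 1) * (N + 2)) * real (legendre_coeff (Suc n) (Suc k))
       + \<sigma> * 5 * (2 * N + 3) * K / ((N + 1) * (N + 2)) * real (legendre_coeff (Suc n) k))"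
    proof -
      have "telescoper_b (Suc n) (Suc k) = telescoper_a (Suc n) (Suc k) * y
         + \<sigma> * 5 * (2 * N + 3) * (K + 1) / ((N + 1) * (N + 2))
             * real (legendre_coeff (Suc n) (Suc k))"
        by (simp add: telescoper_b_def y_def \<sigma>_def N_def K_def add_ac)
      moreover have "telescoper_b (Suc n) k = telescoper_a (Suc n) k * x
         - \<sigma> * 5 * (2 * N + 3) * K / ((N + 1) * (N + 2)) * real (legendre_coeff (Suc n) k)"
        by (simp add: telescoper_b_def x_def \<sigma>_def N_def K_def add_ac)
      ultimately show ?thesis
        unfolding xy by (simp add: left_diff_distrib right_diff_distrib)
    qed
    also have "telescoper_a (Suc n) k
        * (\<sigma> / (2 * (K + 1) ^ 3 * real (legendre_coeff (Suc n) (Suc k))))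
       + \<sigma> * 5 * (2 * N + 3) * (K + 1) / ((N + 1) * (N + 2)) * real (legendre_coeff (Suc n) (Suc k))
       + \<sigma> * 5 * (2 * N + 3) * K / ((N + 1) * (N + 2)) * real (legendre_coeff (Suc n) k)
      = - ((N + 2) ^ 3 * (real (legendre_coeff (Suc (Suc n)) (Suc k)) ^ 2
          * (\<sigma> / ((N + 2)\<^sup>2 * (N + K + 3) * real (legendre_coeff (Suc n) (Suc k))))))
        + (N + 1) ^ 3 * (\<sigma> / ((N + 1)\<^sup>2 * (N + K + 2)) * real (legendre_coeff n (Suc k)))"
    proof -
      \<comment> \<open>The sum of the three terms on the left is \<open>\<sigma> s\<close> times a rational function whose only poles are
        at \<open>N + K + 2 = 0\<close> and \<open>E = 0\<close>, and so is the right-hand side. Each term is brought to this form separately.\<close>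
      define E where "E = N + 1 - K"
      have E0: "E \<noteq> 0" using D by (simp add: E_def)
      show ?thesis
      proof -
        let ?p = "N + K + 2" and ?q = "N + K + 3" and ?r = "K * (2 * K + 1) - (2 * N + 3)\<^sup>2"
        have BS: "telescoper_a (Suc n) k = 4 * (2 * N + 3) * ?r * (s * (K + 1)\<^sup>2)\<^sup>2"
          unfolding telescoper_a_def s' of_nat_Suc N_def[symmetric] K_def[symmetric] by algebra
        have "4 * (2 * N + 3) * ?r * (s * (K + 1)\<^sup>2)\<^sup>2 *
              (\<sigma> / (2 * (K + 1) ^ 3 * (s * ?p * E)))
            = \<sigma> * s * (2 * (2 * N + 3) * ?r * (K + 1)) / (?p * E)"
          using nz E0 s0 by (simp add: divide_simps) algebra
        moreover have "\<sigma> * 5 * (2 * N + 3) * (K + 1) / ((N + 1) * (N + 2)) * (s * ?p * E)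
            + \<sigma> * 5 * (2 * N + 3) * K / ((N + 1) * (N + 2)) * (s * (K + 1)\<^sup>2)
            = \<sigma> * s * (5 * (2 * N + 3) * (K + 1))"
        proof -
          have "?p * E + K * (K + 1) = (N + 1) * (N + 2)" unfolding E_def by algebra
          hence "\<sigma> * s * (5 * (2 * N + 3) * (K + 1)) * ((N + 1) * (N + 2))
            = \<sigma> * 5 * (2 * N + 3) * (K + 1) * (s * ?p * E) + \<sigma> * 5 * (2 * N + 3) * K * (s * (K + 1)\<^sup>2)"
            by algebra
          hence "\<sigma> * s * (5 * (2 * N + 3) * (K + 1)) =
            (\<sigma> * 5 * (2 * N + 3) * (K + 1) * (s * ?p * E) + \<sigma> * 5 * (2 * N + 3) * K * (s * (K + 1)\<^sup>2))
                / ((N + 1) * (N + 2))"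
            using nz by (intro eq_divide_imp) auto
          thus ?thesis by (simp add: add_divide_distrib)
        qed
        moreover have "(N + 2) ^ 3 * ((s * ?p * ?q)\<^sup>2 * (\<sigma> / ((N + 2)\<^sup>2 * ?q * (s * ?p * E))))
            = \<sigma> * s * ((N + 2) * ?p * ?q) / E"
          using nz E0 s0 by (simp add: divide_simps) algebra
        moreover have "(N + 1) ^ 3 * (\<sigma> / ((N + 1)\<^sup>2 * ?p) * (s * E * (N - K)))
            = \<sigma> * s * ((N + 1) * E * (N - K)) / ?p"
          using nz by (simp add: divide_simps) algebra
        moreover have "\<sigma> * s * (2 * (2 * N + 3) * ?r * (K + 1)) / (?p * E)
            + \<sigma> * s * (5 * (2 * N + 3) * (K + 1))
           = - (\<sigma> * s * ((N + 2) * ?p * ?q) / E) + \<sigma> * s * ((N + 1) * E * (N - K)) / ?p"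
        proof -
          have "2 * (2 * N + 3) * ?r * (K + 1) + 5 * (2 * N + 3) * (K + 1) * (?p * E)
            = - ((N + 2) * ?p * ?q) * ?p + (N + 1) * E * (N - K) * E"
            unfolding E_def by algebra
          hence "\<sigma> * s * (2 * (2 * N + 3) * ?r * (K + 1))
              + \<sigma> * s * (5 * (2 * N + 3) * (K + 1)) * (?p * E)
            = (\<sigma> * s * ((N + 1) * E * (N - K))) * E - (\<sigma> * s * ((N + 2) * ?p * ?q)) * ?p"
            by algebra
          thus ?thesis using nz E0 by (simp add: divide_simps)
        qed
        ultimately show ?thesis
          unfolding BS s' E_def[symmetric] by (simp add: mult.assoc)
      qed
    qed
    finally show ?thesis
      unfolding telescoper_a_diff[OF assms] y0 y1 y_def[symmetric]
        by (simp add: N_def K_def algebra_simps)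
  next
    case False
    hence k: "k = Suc n" using assms by simp
    have KN: "K = N + 1" by (simp add: k K_def N_def)
    have nz: "N + 2 \<noteq> 0" "2 * N + 3 \<noteq> 0" "N + 1 \<noteq> 0" using NK by auto
    have t1: "real (legendre_coeff (Suc n) k) = s * (N + 2)\<^sup>2"
      and t2: "real (legendre_coeff (Suc (Suc n)) (Suc k)) = 2 * s * (2 * N + 3) * (N + 2)"
      unfolding s' KN by algebra+
    have tz: "legendre_coeff (Suc n) (Suc k) = 0"
      "legendre_coeff n (Suc k) = 0" by (simp_all add: k legendre_coeff_eq_0)
    have "apery_c (Suc (Suc n)) (Suc k) = x + \<sigma> / ((N + 2)\<^sup>2 * (2 * N + 3) * (s * (N + 2)\<^sup>2))
        + \<sigma> / (2 * (N + 2) ^ 3 * (2 * s * (2 * N + 3) * (N + 2)))"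
      using apery_c_diff_left[of k "Suc n"] apery_c_Suc_right[of "Suc (Suc n)" k] unfolding t1 t2
      by (simp add: x_def \<sigma>_def N_def k add_ac)
    hence "(N + 2) ^ 3 * (real (legendre_coeff (Suc (Suc n)) (Suc k)) ^ 2
        * apery_c (Suc (Suc n)) (Suc k))
       = (N + 2) ^ 3 * real (legendre_coeff (Suc (Suc n)) (Suc k)) ^ 2 * x
         + (N + 2) ^ 3 * (2 * s * (2 * N + 3) * (N + 2)) ^ 2 *
           (\<sigma> / ((N + 2)\<^sup>2 * (2 * N + 3) * (s * (N + 2)\<^sup>2))
            + \<sigma> / (2 * (N + 2) ^ 3 * (2 * s * (2 * N + 3) * (N + 2))))"
      unfolding t2 by (simp only: distrib_left mult.assoc add.assoc)
    also have "(N + 2) ^ 3 * real (legendre_coeff (Suc (Suc n)) (Suc k)) ^ 2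
        = - telescoper_a (Suc n) k"
      using telescoper_a_diff[OF assms] by (simp add: tz telescoper_a_def N_def)
    also have "(N + 2) ^ 3 * (2 * s * (2 * N + 3) * (N + 2)) ^ 2 *
           (\<sigma> / ((N + 2)\<^sup>2 * (2 * N + 3) * (s * (N + 2)\<^sup>2))
            + \<sigma> / (2 * (N + 2) ^ 3 * (2 * s * (2 * N + 3) * (N + 2))))
       = 5 * \<sigma> * s * (2 * N + 3) * (N + 2)"
      using nz s0 by (simp add: divide_simps) algebra
    also have "- telescoper_a (Suc n) k * x + 5 * \<sigma> * s * (2 * N + 3) * (N + 2)
        = - telescoper_b (Suc n) k"
    proof -
      have "telescoper_b (Suc n) k = telescoper_a (Suc n) k * x
         - \<sigma> * 5 * (2 * N + 3) * (N + 1) / ((N + 1) * (N + 2)) * (s * (N + 2)\<^sup>2)"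
        unfolding telescoper_b_def t1 by (simp add: x_def \<sigma>_def k N_def add_ac)
      also have "\<sigma> * 5 * (2 * N + 3) * (N + 1) / ((N + 1) * (N + 2)) * (s * (N + 2)\<^sup>2)
         = 5 * \<sigma> * s * (2 * N + 3) * (N + 2)"
        using nz by (simp add: divide_simps) algebra
      finally show ?thesis by simp
    qed
    finally show ?thesis
      by (simp add: tz N_def telescoper_b_def telescoper_a_def)
  qed
qed

definition apery_a :: "nat \<Rightarrow> real" where "apery_a n = (\<Sum>k\<le>n. real (legendre_coeff n k) ^ 2)"

definition apery_b :: "nat \<Rightarrow> real" where
  "apery_b n = (\<Sum>k\<le>n. real (legendre_coeff n k) ^ 2 * apery_c n k)"

lemma apery_a_extend: "n \<le> m \<Longrightarrow> apery_a n = (\<Sum>k\<le>m. real (legendre_coeff n k) ^ 2)"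
  unfolding apery_a_def by (rule sum.mono_neutral_left) (auto simp: legendre_coeff_eq_0)

lemma apery_b_extend: "n \<le> m \<Longrightarrow> apery_b n = (\<Sum>k\<le>m. real (legendre_coeff n k) ^ 2 * apery_c n k)"
  unfolding apery_b_def by (rule sum.mono_neutral_left) (auto simp: legendre_coeff_eq_0)

lemma telescoping_sum:
  fixes F G :: "nat \<Rightarrow> real"
  assumes "\<And>k. k \<le> n \<Longrightarrow> F (Suc k) - F k = G (Suc k)" "G 0 = F 0"
  shows "(\<Sum>k\<le>Suc n. G k) = F (Suc n)"
proof -
  have "(\<Sum>k\<le>Suc n. G k) = G 0 + (\<Sum>k\<le>n. G (Suc k))"
    by (rule sum.atMost_Suc_shift)
  also have "(\<Sum>k\<le>n. G (Suc k)) = (\<Sum>k<Suc n. F (Suc k) - F k)"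
    using assms(1) by (simp add: lessThan_Suc_atMost)
  also have "\<dots> = F (Suc n) - F 0"
    by (rule sum_lessThan_telescope)
  finally show ?thesis using assms(2) by simp
qed

lemma apery_a_recurrence:
  "(real n + 2) ^ 3 * apery_a (Suc (Suc n)) - apery_poly (real n + 1) * apery_a (Suc n)
      + (real n + 1) ^ 3 * apery_a n = 0"
proof -
  let ?G = "\<lambda>k. (real n + 2) ^ 3 * real (legendre_coeff (Suc (Suc n)) k) ^ 2
    - apery_poly (real n + 1) * real (legendre_coeff (Suc n) k) ^ 2
        + (real n + 1) ^ 3 * real (legendre_coeff n k) ^ 2"
  have "(\<Sum>k\<le>Suc (Suc n). ?G k) = telescoper_a (Suc n) (Suc (Suc n))"
  proof (rule telescoping_sum)
    show "?G 0 = telescoper_a (Suc n) 0"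
      by (simp add: telescoper_a_def apery_poly_def) algebra
  qed (use telescoper_a_diff in auto)
  also have "telescoper_a (Suc n) (Suc (Suc n)) = 0"
    by (simp add: telescoper_a_def legendre_coeff_eq_0)
  finally show ?thesis
    using apery_a_extend[of n "Suc (Suc n)"] apery_a_extend[of "Suc n" "Suc (Suc n)"]
      apery_a_extend[of "Suc (Suc n)" "Suc (Suc n)"]
    by (simp add: sum.distrib sum_subtractf sum_distrib_left del: sum.atMost_Suc)
qed

lemma apery_b_recurrence:
  "(real n + 2) ^ 3 * apery_b (Suc (Suc n)) - apery_poly (real n + 1) * apery_b (Suc n)
      + (real n + 1) ^ 3 * apery_b n = 0"
proof -
  let ?G = "\<lambda>k. (real n + 2) ^ 3
      * (real (legendre_coeff (Suc (Suc n)) k) ^ 2 * apery_c (Suc (Suc n)) k)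
    - apery_poly (real n + 1) * (real (legendre_coeff (Suc n) k) ^ 2 * apery_c (Suc n) k)
    + (real n + 1) ^ 3 * (real (legendre_coeff n k) ^ 2 * apery_c n k)"
  have "(\<Sum>k\<le>Suc (Suc n). ?G k) = telescoper_b (Suc n) (Suc (Suc n))"
  proof (rule telescoping_sum)
    have c2: "apery_c (Suc (Suc n)) 0 = apery_c (Suc n) 0 + 1 / (real n + 2) ^ 3"
      and c0: "apery_c n 0 = apery_c (Suc n) 0 - 1 / (real n + 1) ^ 3"
      by (simp_all add: apery_c_def add_ac)
    have "?G 0 = ((real n + 2) ^ 3 - apery_poly (real n + 1) + (real n + 1) ^ 3) * apery_c (Suc n) 0
       + (real n + 2) ^ 3 * (1 / (real n + 2) ^ 3) - (real n + 1) ^ 3 * (1 / (real n + 1) ^ 3)"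
      unfolding c2 c0 by (simp only: legendre_coeff_0_right of_nat_1 power_one mult_1_left distrib_left distrib_right
        left_diff_distrib right_diff_distrib)
    also have "(real n + 2) ^ 3 * (1 / (real n + 2) ^ 3) = 1" by simp
    also have "(real n + 1) ^ 3 * (1 / (real n + 1) ^ 3) = 1"
      by (simp add: add_nonneg_eq_0_iff)
    also have "(real n + 2) ^ 3 - apery_poly (real n + 1) + (real n + 1) ^ 3 = telescoper_a (Suc n) 0"
      by (simp add: telescoper_a_def apery_poly_def) algebra
    finally show "?G 0 = telescoper_b (Suc n) 0" by (simp add: telescoper_b_def)
  qed (use telescoper_b_diff in auto)
  also have "telescoper_b (Suc n) (Suc (Suc n)) = 0"
    by (simp add: telescoper_b_def telescoper_a_def legendre_coeff_eq_0)
  finally show ?thesis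
    using apery_b_extend[of n "Suc (Suc n)"] apery_b_extend[of "Suc n" "Suc (Suc n)"]
      apery_b_extend[of "Suc (Suc n)" "Suc (Suc n)"]
    by (simp add: sum.distrib sum_subtractf sum_distrib_left del: sum.atMost_Suc)
qed

section \<open>Divisibility and growth of lcm(1, ..., n)\<close>

definition lcm_upto :: "nat \<Rightarrow> nat" where "lcm_upto n = Lcm {1..n}"

lemma lcm_upto_pos: "lcm_upto n > 0"
proof -
  have "lcm_upto n \<noteq> 0" by (simp add: lcm_upto_def Lcm_0_iff)
  thus ?thesis by (rule neq0_conv[THEN iffD1])
qed

lemma dvd_lcm_upto: "1 \<le> m \<Longrightarrow> m \<le> n \<Longrightarrow> m dvd lcm_upto n"
  unfolding lcm_upto_def by (rule dvd_Lcm) simp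

lemma prime_power_dvd_iff:
  fixes p x :: nat
  assumes "prime p" "x > 0"
  shows "p ^ i dvd x \<longleftrightarrow> i \<le> multiplicity p x"
  by (rule power_dvd_iff_le_multiplicity) (use assms prime_gt_1_nat[OF assms(1)] in auto)

text \<open>
  Legendre's formula. The upper limit \<open>L\<close> is arbitrary, so that the formulas for the factorials of \<open>n\<close>,
  \<open>n div 2\<close> and so on can be added up term by term.
\<close>

lemma multiplicity_fact:
  fixes p :: nat
  assumes p: "prime p" and "n \<le> L"
  shows "multiplicity p (fact n) = (\<Sum>i=1..L. n div p ^ i)"
  using assms(2)
proof (induction n)
  case (Suc n)
  have "multiplicity p (fact (Suc n)) = multiplicity p (Suc n) + multiplicity p (fact n)"
    using p by (simp add: prime_elem_multiplicity_mult_distrib del: mult_Suc)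
  also have "multiplicity p (Suc n) = card {i \<in> {1..L}. p ^ i dvd Suc n}"
  proof -
    have "p ^ i dvd Suc n \<longleftrightarrow> i \<le> multiplicity p (Suc n)" for i
      by (rule prime_power_dvd_iff[OF p]) simp
    moreover have "multiplicity p (Suc n) \<le> L"
    proof -
      let ?e = "multiplicity p (Suc n)"
      have "?e < p ^ ?e" by (rule power_gt_expt) (use prime_ge_2_nat[OF p] in simp)
      also have "p ^ ?e \<le> Suc n" by (rule dvd_imp_le[OF multiplicity_dvd]) simp
      finally show ?thesis using Suc.prems by simp
    qed
    ultimately have "{i \<in> {1..L}. p ^ i dvd Suc n} = {1..multiplicity p (Suc n)}"
      by (intro set_eqI) (use dual_order.trans in \<open>simp, blast\<close>)
    thus ?thesis by (simp only: card_atLeastAtMost)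
  qed
  also have "\<dots> = (\<Sum>i=1..L. if p ^ i dvd Suc n then 1 else 0)"
    by (simp add: sum.If_cases Int_def)
  also have "multiplicity p (fact n) = (\<Sum>i=1..L. n div p ^ i)"
    using Suc by simp
  also have "(\<Sum>i=1..L. if p ^ i dvd Suc n then 1 else 0) + (\<Sum>i=1..L. n div p ^ i)
      = (\<Sum>i=1..L. Suc n div p ^ i)"
    unfolding sum.distrib[symmetric] by (rule sum.cong) (auto simp: div_Suc dvd_eq_mod_eq_0)
  finally show ?case .
qed auto

lemma fact_quotient:
  obtains M :: nat where
    "fact n = M * (fact (n div 2) * fact (n div 3) * fact (n div 7) * fact (n div 42))"
proof -
  have "fact (n div 2) * fact (n div 3) * fact (n div 7) * fact (n div 42) dvd
     (fact (n div 2 + n div 3 + n div 7 + n div 42) :: nat)"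
    by (meson dvd_trans fact_fact_dvd_fact mult_dvd_mono dvd_refl)
  also have "\<dots> dvd fact n" by (rule fact_dvd) linarith
  finally show ?thesis using that by (metis dvd_def mult.commute)
qed

lemma unit_fractions_le: "q div 2 + q div 3 + q div 7 + q div 42 \<le> (q :: nat)"
  by linarith

lemma unit_fractions_less: "1 \<le> q \<Longrightarrow> q < 42 \<Longrightarrow> q div 2 + q div 3 + q div 7 + q div 42 < (q :: nat)"
  using div_less[of q 42] by linarith

text \<open>
  By Legendre's formula the multiplicity of \<open>p\<close> in \<open>M\<close> is a sum over \<open>i\<close> of terms \<open>g (n div p\<^sup>i)\<close> with
  \<open>g q = q - q div 2 - q div 3 - q div 7 - q div 42\<close>. These are never negative, and they are at least \<open>1\<close> if
  \<open>1 \<le> n div p\<^sup>i < 42\<close>, that is, for those prime powers up to \<open>n\<close> that exceed \<open>n div 42\<close>.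
\<close>

lemma lcm_upto_dvd:
  assumes M: "fact n = M * (fact (n div 2) * fact (n div 3) * fact (n div 7) * fact (n div 42))"
  shows "lcm_upto n dvd lcm_upto (n div 42) * M"
  unfolding lcm_upto_def[of n]
proof (rule Lcm_least)
  fix m assume m: "m \<in> {1..n}"
  have M0: "M > 0" using M fact_gt_zero[of n, where 'a = nat] by (cases M) auto
  show "m dvd lcm_upto (n div 42) * M"
  proof (rule multiplicity_le_imp_dvd)
    fix p :: nat assume p: "prime p"
    define e where "e = multiplicity p m"
    define f where "f = multiplicity p (lcm_upto (n div 42))"
    let ?g = "\<lambda>q. q - (q div 2 + q div 3 + q div 7 + q div 42) :: nat"
    have "multiplicity p (fact n) = multiplicity p M + (multiplicity p (fact (n div 2))
       + multiplicity p (fact (n div 3)) + multiplicity p (fact (n div 7))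
           + multiplicity p (fact (n div 42)))"
      unfolding M using p M0 by (simp add: prime_elem_multiplicity_mult_distrib)
    moreover have "multiplicity p (fact (n div k)) = (\<Sum>i=1..n. (n div p ^ i) div k)" for k
      using multiplicity_fact[OF p, of "n div k" n]
        by (simp add: div_mult2_eq[symmetric] mult.commute)
    moreover have "multiplicity p (fact n) = (\<Sum>i=1..n. n div p ^ i)"
      using multiplicity_fact[OF p, of n n] by simp
    ultimately have "(\<Sum>i=1..n. n div p ^ i)
        = multiplicity p M + (\<Sum>i=1..n. (n div p ^ i) div 2 + (n div p ^ i) div 3
      + (n div p ^ i) div 7 + (n div p ^ i) div 42)"
      by (simp add: sum.distrib)
    moreover have "(\<Sum>i=1..n. n div p ^ i)
        = (\<Sum>i=1..n. ?g (n div p ^ i)) + (\<Sum>i=1..n. (n div p ^ i) div 2 + (n div p ^ i) div 3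
      + (n div p ^ i) div 7 + (n div p ^ i) div 42)"
      unfolding sum.distrib[symmetric]
        by (rule sum.cong[OF refl]) (rule le_add_diff_inverse2[OF unit_fractions_le, symmetric])
    ultimately have vM: "multiplicity p M = (\<Sum>i=1..n. ?g (n div p ^ i))" by linarith
    have pe: "p ^ i \<le> n" if "i \<le> e" for i
    proof -
      have "p ^ i dvd m" using that unfolding e_def by (rule multiplicity_dvd')
      hence "p ^ i \<le> m" by (rule dvd_imp_le) (use m in auto)
      thus ?thesis using m by auto
    qed
    have "1 \<le> ?g (n div p ^ i)" if i: "i \<in> {f+1..e}" for i
    proof -
      have p0: "p ^ i > 0" using p by (simp add: prime_gt_0_nat)
      \<comment> \<open>Beyond the exponent \<open>f\<close> the power cannot be one of \<open>1, \<dots>, n div 42\<close>.\<close>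
      have "\<not> p ^ i dvd lcm_upto (n div 42)"
        using i by (simp add: prime_power_dvd_iff[OF p lcm_upto_pos] f_def)
      hence "\<not> p ^ i \<le> n div 42" using dvd_lcm_upto[of "p ^ i" "n div 42"] p0 by auto
      hence "n < 42 * p ^ i" by simp
      hence "n div p ^ i < 42" using p0 by (simp add: div_less_iff_less_mult)
      moreover have "n div p ^ i \<ge> 1"
        using pe[of i] i p0 by (simp add: Suc_le_eq div_greater_zero_iff)
      ultimately show ?thesis using unit_fractions_less[of "n div p ^ i"]
        by (metis less_eq_Suc_le One_nat_def zero_less_diff)
    qed
    hence "(\<Sum>i\<in>{f+1..e}. 1) \<le> (\<Sum>i\<in>{f+1..e}. ?g (n div p ^ i))" by (rule sum_mono)
    also have "\<dots> \<le> (\<Sum>i=1..n. ?g (n div p ^ i))"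
    proof (rule sum_mono2)
      have "e < p ^ e" by (rule power_gt_expt) (use prime_ge_2_nat[OF p] in simp)
      hence "e \<le> n" using pe[of e] by simp
      thus "{f + 1..e} \<subseteq> {1..n}" by auto
    qed auto
    finally have "e \<le> f + multiplicity p M" using vM by simp
    thus "multiplicity p m \<le> multiplicity p (lcm_upto (n div 42) * M)"
      using p M0 lcm_upto_pos[of "n div 42"]
        by (simp add: prime_elem_multiplicity_mult_distrib e_def f_def)
  qed (use m in auto)
qed

text \<open>
  One term of the binomial expansion is at most the whole power. In this form the inequality can be iterated,
  which gives the multinomial version that is needed next.
\<close>

lemma power_over_fact_mult_le:
  fixes p q :: real
  assumes "p \<ge> 0" "q \<ge> 0"
  shows "(p ^ i / fact i) * (q ^ j / fact j) \<le> (p + q) ^ (i + j) / fact (i + j)"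
proof -
  have "real ((i + j) choose i) * p ^ i * q ^ (i + j - i)
      \<le> (\<Sum>k\<le>i + j. real ((i + j) choose k) * p ^ k * q ^ (i + j - k))"
    by (rule member_le_sum) (use assms in auto)
  hence "real ((i + j) choose i) * p ^ i * q ^ j \<le> (p + q) ^ (i + j)"
    by (simp add: binomial_ring)
  moreover have "real ((i + j) choose i) = fact (i + j) / (fact i * fact j)"
    by (simp add: binomial_fact)
  ultimately show ?thesis by (simp add: field_simps)
qed

text \<open>
  With \<open>m\<close> the sum of the four quotients, the multinomial theorem for \<open>(1/2 + 1/3 + 1/7 + 1/42)\<^sup>m = 1\<close> bounds
  \<open>m!\<close> divided by the four factorials. Each rounding loses less than \<open>1\<close>, so \<open>m \<ge> n - 3\<close>, and passing from
  \<open>m!\<close> to \<open>n!\<close> costs at most a factor of \<open>n\<^sup>3\<close>.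
\<close>

lemma fact_quotient_bound:
  assumes M: "fact n = M * (fact (n div 2) * fact (n div 3) * fact (n div 7) * fact (n div 42))"
    and n: "n > 0"
  shows "real M \<le> real n ^ 3 * (2 ^ (n div 2) * 3 ^ (n div 3) * 7 ^ (n div 7) * 42 ^ (n div 42))"
proof -
  define k1 k2 k3 k4 where k: "k1 = n div 2" "k2 = n div 3" "k3 = n div 7" "k4 = n div 42"
  define m where "m = k1 + (k2 + (k3 + k4))"
  have m: "m \<le> n" "n \<le> m + 3" unfolding m_def k by linarith+
  let ?h = "\<lambda>p k. p ^ k / fact k :: real"
  have "?h (1/7) k3 * ?h (1/42) k4 \<le> ?h (1/6) (k3 + k4)"
    using power_over_fact_mult_le[of "1/7" "1/42" k3 k4] by simp
  hence "?h (1/3) k2 * (?h (1/7) k3 * ?h (1/42) k4) \<le> ?h (1/3) k2 * ?h (1/6) (k3 + k4)"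
    by (rule mult_left_mono) simp
  also have "\<dots> \<le> ?h (1/2) (k2 + (k3 + k4))"
    using power_over_fact_mult_le[of "1/3" "1/6" k2 "k3 + k4"] by simp
  finally have "?h (1/2) k1 * (?h (1/3) k2 * (?h (1/7) k3 * ?h (1/42) k4))
      \<le> ?h (1/2) k1 * ?h (1/2) (k2 + (k3 + k4))"
    by (rule mult_left_mono) simp
  also have "\<dots> \<le> ?h 1 m"
    using power_over_fact_mult_le[of "1/2" "1/2" k1 "k2 + (k3 + k4)"] by (simp add: m_def)
  finally have "fact m \<le> fact k1 * fact k2 * fact k3 * fact k4
      * (2 ^ k1 * 3 ^ k2 * 7 ^ k3 * 42 ^ k4 :: real)"
    by (simp add: field_simps power_divide)
  moreover have "fact n \<le> real n ^ 3 * fact m"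
  proof -
    have "(fact n :: nat) = fact n div fact m * fact m"
      using fact_dvd[OF m(1), where 'a = nat] by simp
    also have "\<dots> \<le> n ^ (n - m) * fact m"
      using fact_div_fact_le_pow[of "n - m" n] m by simp
    also have "\<dots> \<le> n ^ 3 * fact m"
      using m n by (intro mult_right_mono power_increasing) auto
    finally have "real (fact n) \<le> real (n ^ 3 * fact m)" by (simp only: of_nat_le_iff)
    thus ?thesis by simp
  qed
  ultimately have "fact n \<le> real n ^ 3
      * (fact k1 * fact k2 * fact k3 * fact k4 * (2 ^ k1 * 3 ^ k2 * 7 ^ k3 * 42 ^ k4))"
    by (meson mult_left_mono order_trans zero_le_power of_nat_0_le_iff)
  moreover have "fact n = real M * (fact k1 * fact k2 * fact k3 * fact k4)"
    using arg_cong[OF M, of real] by (simp add: k)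
  ultimately have "real M * (fact k1 * fact k2 * fact k3 * fact k4) \<le>
     (real n ^ 3 * (2 ^ k1 * 3 ^ k2 * 7 ^ k3 * 42 ^ k4)) * (fact k1 * fact k2 * fact k3 * fact k4)"
    by (simp add: mult_ac)
  thus ?thesis unfolding k[symmetric] by (rule mult_right_le_imp_le) simp
qed

text \<open>
  Raising to the power \<open>42\<close> turns exponents such as \<open>n / 7\<close> into integers.
\<close>

lemma lcm_upto_step:
  assumes n: "n > 0"
  shows "real (lcm_upto n) ^ 42
      \<le> real (lcm_upto (n div 42)) ^ 42 * real n ^ 126 * (2 ^ 21 * 3 ^ 14 * 7 ^ 6 * 42) ^ n"
proof -
  obtain M :: nat where M: "fact n
      = M * (fact (n div 2) * fact (n div 3) * fact (n div 7) * fact (n div 42))"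
    by (rule fact_quotient[where n = n])
  have "M > 0" using M fact_gt_zero[of n, where 'a = nat] by (cases M) auto
  hence "lcm_upto n \<le> lcm_upto (n div 42) * M"
    using lcm_upto_dvd[OF M] lcm_upto_pos[of "n div 42"] by (intro dvd_imp_le) auto
  hence "real (lcm_upto n) \<le> real (lcm_upto (n div 42)) * real M"
    by (metis of_nat_le_iff of_nat_mult)
  also have "\<dots> \<le> real (lcm_upto (n div 42))
      * (real n ^ 3 * (2 ^ (n div 2) * 3 ^ (n div 3) * 7 ^ (n div 7) * 42 ^ (n div 42)))"
    by (intro mult_left_mono fact_quotient_bound M n) auto
  finally have "real (lcm_upto n) ^ 42
      \<le> (real (lcm_upto (n div 42))
      * (real n ^ 3 * (2 ^ (n div 2) * 3 ^ (n div 3) * 7 ^ (n div 7) * 42 ^ (n div 42)))) ^ 42"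
    by (rule power_mono) simp
  also have "\<dots> = real (lcm_upto (n div 42)) ^ 42
      * (real n ^ 126 * (2 ^ (n div 2 * 42) * 3 ^ (n div 3 * 42) * 7 ^ (n div 7 * 42)
      * 42 ^ (n div 42 * 42)))"
    by (simp only: power_mult_distrib power_mult[symmetric]) simp
  also have "\<dots> \<le> real (lcm_upto (n div 42)) ^ 42
      * (real n ^ 126 * (2 ^ (21 * n) * 3 ^ (14 * n) * 7 ^ (6 * n) * 42 ^ n))"
  proof -
    have "n div 2 * 42 \<le> 21 * n" "n div 3 * 42 \<le> 14 * n" "n div 7 * 42 \<le> 6 * n" "n div 42 * 42 \<le> n"
      by linarith+
    hence "(2 :: real) ^ (n div 2 * 42) \<le> 2 ^ (21 * n)" "(3 :: real) ^ (n div 3 * 42) \<le> 3 ^ (14 * n)"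
      "(7 :: real) ^ (n div 7 * 42) \<le> 7 ^ (6 * n)" "(42 :: real) ^ (n div 42 * 42) \<le> 42 ^ n"
      by (intro power_increasing; simp)+
    thus ?thesis by (intro mult_left_mono mult_mono) auto
  qed
  finally show ?thesis by (simp only: power_mult_distrib power_mult mult.assoc)
qed

text \<open>
  Induction with \<open>lcm_upto_step\<close>. With \<open>Q = 2\<^sup>2\<^sup>1 3\<^sup>1\<^sup>4 7\<^sup>6 42\<close>, the step from \<open>n div 42\<close> to \<open>n\<close> succeeds as soon as
  \<open>n\<^sup>1\<^sup>2\<^sup>6 (Q / 3.1\<^sup>4\<^sup>1)\<^sup>n \<le> 1\<close>. Since \<open>Q < 3.1\<^sup>4\<^sup>1\<close>, this holds for all large \<open>n\<close>, and the constant takes care of the rest.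
\<close>

lemma lcm_upto_bound: "\<exists>C>0. \<forall>n. real (lcm_upto n) \<le> C * (31 / 10) ^ n"
proof -
  define Q :: real where "Q = 2 ^ 21 * 3 ^ 14 * 7 ^ 6 * 42"
  \<comment> \<open>A rational number above the \<open>126\<close>-th root of \<open>Q / 3.1\<^sup>4\<^sup>1 \<approx> 0.354\<close>, so that it suffices to have
    \<open>n x\<^sup>n \<le> 1\<close>.\<close>
  define x :: real where "x = 124 / 125"
  have Qx: "Q \<le> (31 / 10) ^ 41 * x ^ 126"
    unfolding Q_def x_def by (simp add: divide_simps)
  have "(\<lambda>n. real n * x ^ n) \<longlonglongrightarrow> 0"
    by (rule powser_times_n_limit_0) (simp add: x_def)
  hence "eventually (\<lambda>n. real n * x ^ n < 1) sequentially"
    by (rule order_tendstoD) simp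
  then obtain N where N: "\<And>n. n \<ge> N \<Longrightarrow> real n * x ^ n < 1"
    by (auto simp: eventually_sequentially)
  define C where "C = Max ((\<lambda>n. real (lcm_upto n)) ` {..N})"
  have C: "real (lcm_upto n) \<le> C" if "n \<le> N" for n
    unfolding C_def using that by (intro Max_ge) auto
  have C0: "C > 0" using C[of 0] lcm_upto_pos[of 0] by simp
  have "real (lcm_upto n) \<le> C * (31 / 10) ^ n" for n
  proof (induction n rule: less_induct)
    case (less n)
    show ?case
    proof (cases "n \<le> N")
      case True
      have "C * 1 \<le> C * (31 / 10) ^ n" using C0 by (intro mult_left_mono one_le_power) auto
      thus ?thesis using C[OF True] by simp
    next
      case False
      have IH: "real (lcm_upto (n div 42)) \<le> C * (31 / 10) ^ (n div 42)"
        using False by (intro less.IH) simp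
      have "real (lcm_upto n) ^ 42 \<le> real (lcm_upto (n div 42)) ^ 42 * real n ^ 126 * Q ^ n"
        unfolding Q_def by (rule lcm_upto_step) (use False in simp)
      also have "\<dots> \<le> (C * (31 / 10) ^ (n div 42)) ^ 42 * real n ^ 126
          * ((31 / 10) ^ 41 * x ^ 126) ^ n"
        using IH Qx C0 by (intro mult_mono power_mono) (auto simp: Q_def x_def)
      also have "\<dots> = C ^ 42 * (31 / 10) ^ (n div 42 * 42 + 41 * n) * (real n * x ^ n) ^ 126"
        by (simp add: power_mult_distrib power_mult[symmetric] power_add mult_ac)
      also have "\<dots> \<le> C ^ 42 * (31 / 10) ^ (42 * n) * 1"
      proof (rule mult_mono)
        show "C ^ 42 * (31 / 10) ^ (n div 42 * 42 + 41 * n) \<le> C ^ 42 * (31 / 10) ^ (42 * n)"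
          using C0 by (intro mult_left_mono power_increasing) auto
        show "(real n * x ^ n) ^ 126 \<le> 1"
          using N[of n] False by (intro power_le_one) (auto simp: x_def)
      qed (use C0 in \<open>auto simp: x_def\<close>)
      also have "\<dots> = (C * (31 / 10) ^ n) ^ 42"
        by (simp add: power_mult_distrib power_mult[symmetric] mult.commute)
      finally show ?thesis by (rule power_le_imp_le_base[where n = 41, simplified]) (use C0 in auto)
    qed
  qed
  thus ?thesis using C0 by blast
qed

text \<open>
  The numbers \<open>1 / (m (n choose m))\<close> are the entries of Leibniz's harmonic triangle: the entry at \<open>m + 1\<close> in row
  \<open>n\<close> is the difference of the entries at \<open>m\<close> in the rows \<open>n - 1\<close> and \<open>n\<close>. As the first entry of row \<open>n\<close>
  is \<open>1 / n\<close>, a common multiple of \<open>1, \<dots>, N\<close> clears the denominators of the rows up to \<open>N\<close>.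
\<close>

lemma lcm_upto_div_binomial_Ints:
  "1 \<le> m \<Longrightarrow> m \<le> n \<Longrightarrow> n \<le> N \<Longrightarrow> real (lcm_upto N) / (real m * real (n choose m)) \<in> \<int>"
proof (induction m arbitrary: n)
  case 0 thus ?case by simp
next
  case (Suc m)
  show ?case
  proof (cases "m = 0")
    case True
    have "n dvd lcm_upto N" using Suc.prems by (intro dvd_lcm_upto) auto
    hence "real (lcm_upto N) / real n = real (lcm_upto N div n)" by (simp add: real_of_nat_div)
    thus ?thesis using True by simp
  next
    case False
    obtain n' where n': "n = Suc n'" using Suc.prems by (cases n) auto
    define X where "X = real (n choose m)"
    have X: "X > 0" using Suc.prems by (simp add: X_def)
    have nm: "real m > 0" "real m < real n" using False Suc.prems by auto
    have 1: "real (Suc m) * real (n choose Suc m) = (real n - real m) * X"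
      using Suc.prems binomial_absorb_comp[of n m] binomial_absorption[of m n]
      unfolding X_def by (metis of_nat_diff of_nat_mult Suc_leD)
    have 2: "real n * real (n' choose m) = (real n - real m) * X"
      using Suc.prems binomial_absorb_comp[of n m]
      unfolding X_def n' by (metis of_nat_diff of_nat_mult Suc_leD diff_Suc_1)
    have 3: "real (n' choose m) = (real n - real m) * X / real n"
      using 2 nm by (simp add: field_simps)
    have "real (lcm_upto N) / (real (Suc m) * real (n choose Suc m)) =
       real (lcm_upto N) / (real m * real (n' choose m)) - real (lcm_upto N) / (real m * X)"
      unfolding 1 3 using nm X by (simp add: divide_simps) (simp add: algebra_simps)
    moreover have "real (lcm_upto N) / (real m * real (n' choose m)) \<in> \<int>"
      "real (lcm_upto N) / (real m * X) \<in> \<int>"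
      unfolding X_def using False Suc.prems n' by (intro Suc.IH; simp)+
    ultimately show ?thesis by simp
  qed
qed

section \<open>Convergence and speed of convergence\<close>

lemma apery_a_0 [simp]: "apery_a 0 = 1" and apery_a_1 [simp]: "apery_a (Suc 0) = 5"
  and apery_b_0 [simp]: "apery_b 0 = 0" and apery_b_1 [simp]: "apery_b (Suc 0) = 6"
  by (simp_all add: apery_a_def apery_b_def apery_c_def legendre_coeff_def)

text \<open>
  Eliminating the middle terms from the two recurrences shows that the left-hand side does not depend on \<open>n\<close>.
\<close>

lemma apery_casoratian: "(real n + 1) ^ 3
    * (apery_b (Suc n) * apery_a n - apery_a (Suc n) * apery_b n) = 6"
proof (induction n)
  case (Suc n)
  have "(real n + 2) ^ 3 * (apery_b (Suc (Suc n)) * apery_a (Suc n)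
      - apery_a (Suc (Suc n)) * apery_b (Suc n))
      = (real n + 1) ^ 3 * (apery_b (Suc n) * apery_a n - apery_a (Suc n) * apery_b n)"
    using apery_a_recurrence[of n] apery_b_recurrence[of n] by algebra
  thus ?case using Suc by (simp add: add_ac)
qed simp

lemma legendre_coeff_le_Suc: "legendre_coeff n k \<le> legendre_coeff (Suc n) k"
  unfolding legendre_coeff_def by (intro mult_mono binomial_right_mono) auto

lemma apery_a_le_Suc: "apery_a n \<le> apery_a (Suc n)"
proof -
  have "apery_a n \<le> (\<Sum>k\<le>n. real (legendre_coeff (Suc n) k) ^ 2)"
    unfolding apery_a_def by (intro sum_mono power_mono) (auto simp: legendre_coeff_le_Suc)
  also have "\<dots> \<le> apery_a (Suc n)" unfolding apery_a_def by simp
  finally show ?thesis .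
qed

lemma apery_a_ge_1: "apery_a n \<ge> 1"
proof (induction n)
  case (Suc n) thus ?case using apery_a_le_Suc[of n] by linarith
qed simp

text \<open>
  Monotonicity of \<open>a\<close> and the recurrence at \<open>x = n + 1\<close> give
  \<open>(x + 1)\<^sup>3 a\<^sub>x\<^sub>+\<^sub>1 \<ge> (apery_poly x - x\<^sup>3) a\<^sub>x\<close>, and the factor on the right has the leading term \<open>33 x\<^sup>3\<close>. So it exceeds
  \<open>32 (x + 1)\<^sup>3\<close> for large \<open>x\<close>.
\<close>

lemma apery_a_growth:
  assumes "n \<ge> 47"
  shows "32 * apery_a (Suc n) \<le> apery_a (Suc (Suc n))"
proof -
  define x where "x = real n + 1"
  have x: "x \<ge> 48" using assms by (simp add: x_def)
  have "32 * (x + 1) ^ 3 \<le> apery_poly x - x ^ 3"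
  proof -
    \<comment> \<open>Division with remainder by \<open>x - 48\<close>; the quotient and the remainder are positive.\<close>
    have "x ^ 3 - 45 * x\<^sup>2 - 69 * x - 27 = (x - 48) * (x\<^sup>2 + 3 * x + 75) + 3573"
      by algebra
    moreover have "(x - 48) * (x\<^sup>2 + 3 * x + 75) \<ge> 0" using x by (intro mult_nonneg_nonneg) auto
    ultimately have "x ^ 3 - 45 * x\<^sup>2 - 69 * x - 27 \<ge> 0" by linarith
    moreover have "apery_poly x - x ^ 3 - 32 * (x + 1) ^ 3 = x ^ 3 - 45 * x\<^sup>2 - 69 * x - 27"
      unfolding apery_poly_def by algebra
    ultimately show ?thesis by linarith
  qed
  hence "(32 * (x + 1) ^ 3) * apery_a (Suc n) \<le> (apery_poly x - x ^ 3) * apery_a (Suc n)"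
    using apery_a_ge_1[of "Suc n"] by (intro mult_right_mono) auto
  also have "\<dots> \<le> apery_poly x * apery_a (Suc n) - x ^ 3 * apery_a n"
    using mult_left_mono[OF apery_a_le_Suc[of n], of "x ^ 3"] x by (simp add: algebra_simps)
  also have "\<dots> = (x + 1) ^ 3 * apery_a (Suc (Suc n))"
    using apery_a_recurrence[of n] by (simp add: x_def add_ac)
  finally have "(x + 1) ^ 3 * (32 * apery_a (Suc n)) \<le> (x + 1) ^ 3 * apery_a (Suc (Suc n))"
    by (simp add: mult_ac)
  moreover have "(x + 1) ^ 3 > 0" using x by simp
  ultimately show ?thesis by (simp only: mult_le_cancel_left_pos)
qed

lemma apery_a_ge_power: "apery_a (48 + n) \<ge> 32 ^ n"
proof (induction n)
  case 0 show ?case using apery_a_ge_1[of 48] by simp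
next
  case (Suc n)
  thus ?case using apery_a_growth[of "47 + n"] by simp
qed

lemma zeta_3_sums: "(\<lambda>n. 1 / real (Suc n) ^ 3) sums zeta 3"
proof -
  have "summable (\<lambda>n. 1 / real n ^ 3)"
    using inverse_power_summable[of 3, where 'a = real] by (simp add: field_simps)
  hence "summable (\<lambda>n. 1 / real (Suc n) ^ 3)" by (subst summable_Suc_iff)
  moreover have "zeta 3 = (\<Sum>n. 1 / real (Suc n) ^ 3)"
    unfolding zeta_def by (simp add: powr_numeral)
  ultimately show ?thesis by (simp only: summable_sums)
qed

lemma shift_partial_sum: "(\<Sum>m=1..n. 1 / real m ^ 3) = (\<Sum>m<n. 1 / real (Suc m) ^ 3)"
  by (rule sum.reindex_bij_witness[of _ Suc "\<lambda>m. m - 1"]) auto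

lemma partial_sum_le_zeta: "(\<Sum>m=1..n. 1 / real m ^ 3) \<le> zeta 3"
  unfolding shift_partial_sum sums_unique[OF zeta_3_sums]
  by (rule sum_le_suminf) (use zeta_3_sums in \<open>auto simp: sums_iff\<close>)

lemma zeta_3_pos: "zeta 3 > 0" using partial_sum_le_zeta[of 1] by simp

text \<open>
  This crude bound is enough to make the second sum in \<open>apery_c n k\<close> tend to \<open>0\<close>, uniformly in \<open>k\<close>.
\<close>

lemma legendre_coeff_ge: "1 \<le> k \<Longrightarrow> k \<le> n \<Longrightarrow> n + 1 \<le> legendre_coeff n k"
proof -
  assume k: "1 \<le> k" "k \<le> n"
  have "n + 1 = (n + 1) choose n" by simp
  also have "\<dots> \<le> (n + k) choose n" using k by (intro binomial_right_mono) auto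
  also have "\<dots> = (n + k) choose k" by (subst binomial_symmetric) auto
  also have "1 * ((n + k) choose k) \<le> (n choose k) * ((n + k) choose k)"
    using k by (intro mult_right_mono) (auto simp: Suc_le_eq)
  finally show ?thesis by (simp add: legendre_coeff_def)
qed

lemma apery_c_near_partial_sum:
  assumes "k \<le> n"
  shows "\<bar>apery_c n k - (\<Sum>m=1..n. 1 / real m ^ 3)\<bar> \<le> zeta 3 / (real n + 1)"
proof -
  have "\<bar>apery_c n k - (\<Sum>m=1..n. 1 / real m ^ 3)\<bar>
      \<le> (\<Sum>m=1..k. \<bar>(-1) ^ (m + 1) / (2 * real m ^ 3 * real (legendre_coeff n m))\<bar>)"
    unfolding apery_c_def add_diff_cancel_left' by (rule sum_abs)
  also have "\<dots> \<le> (\<Sum>m=1..k. 1 / real m ^ 3 * (1 / (real n + 1)))"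
  proof (rule sum_mono)
    fix m assume m: "m \<in> {1..k}"
    have "real n + 1 \<le> real (legendre_coeff n m)" using legendre_coeff_ge[of m n] m assms
      by (simp del: of_nat_add flip: of_nat_Suc)
    hence "real m ^ 3 * (real n + 1) \<le> 2 * real m ^ 3 * real (legendre_coeff n m)" using m
      by (intro mult_mono) auto
    moreover have "real m ^ 3 * (real n + 1) > 0" using m by simp
    ultimately have "1 / (2 * real m ^ 3 * real (legendre_coeff n m))
        \<le> 1 / (real m ^ 3 * (real n + 1))"
      by (intro frac_le) auto
    thus "\<bar>(-1) ^ (m + 1) / (2 * real m ^ 3 * real (legendre_coeff n m))\<bar>
        \<le> 1 / real m ^ 3 * (1 / (real n + 1))"
      by (simp add: abs_mult power_abs)
  qed
  also have "\<dots> = (\<Sum>m=1..k. 1 / real m ^ 3) * (1 / (real n + 1))"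
    by (rule sum_distrib_right[symmetric])
  also have "\<dots> \<le> zeta 3 * (1 / (real n + 1))"
    by (intro mult_right_mono partial_sum_le_zeta) auto
  finally show ?thesis by simp
qed

text \<open>
  The quotient is a weighted mean of the numbers \<open>apery_c n k\<close> with \<open>k \<le> n\<close>, and these are uniformly close to
  the \<open>n\<close>-th partial sum.
\<close>

lemma apery_quotient_tendsto: "(\<lambda>n. apery_b n / apery_a n) \<longlonglongrightarrow> zeta 3"
proof -
  have "(\<lambda>n. apery_b n / apery_a n - (\<Sum>m=1..n. 1 / real m ^ 3)) \<longlonglongrightarrow> 0"
  proof (rule Lim_null_comparison)
    show "(\<lambda>n. zeta 3 / (real n + 1)) \<longlonglongrightarrow> 0"
      using LIMSEQ_Suc[OF lim_const_over_n[of "zeta 3"]] by (simp add: add_ac)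
    show "\<forall>\<^sub>F n in sequentially. norm (apery_b n / apery_a n - (\<Sum>m=1..n. 1 / real m ^ 3))
        \<le> zeta 3 / (real n + 1)"
    proof (intro always_eventually allI)
      fix n
      let ?s = "\<Sum>m=1..n. 1 / real m ^ 3"
      have "\<bar>apery_b n - apery_a n * ?s\<bar> = \<bar>\<Sum>k\<le>n. real (legendre_coeff n k) ^ 2 * (apery_c n k - ?s)\<bar>"
        by (simp add: apery_a_def apery_b_def sum_distrib_right sum_subtractf right_diff_distrib)
      also have "\<dots> \<le> (\<Sum>k\<le>n. \<bar>real (legendre_coeff n k) ^ 2 * (apery_c n k - ?s)\<bar>)" by (rule sum_abs)
      also have "\<dots> \<le> (\<Sum>k\<le>n. real (legendre_coeff n k) ^ 2 * (zeta 3 / (real n + 1)))"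
        unfolding abs_mult abs_power2 using apery_c_near_partial_sum
          by (intro sum_mono mult_left_mono) auto
      also have "\<dots> = apery_a n * (zeta 3 / (real n + 1))"
        unfolding apery_a_def by (rule sum_distrib_right[symmetric])
      finally have "\<bar>apery_b n - apery_a n * ?s\<bar> \<le> apery_a n * (zeta 3 / (real n + 1))" .
      moreover have "apery_b n - apery_a n * ?s = apery_a n * (apery_b n / apery_a n - ?s)"
        using apery_a_ge_1[of n] by (simp add: algebra_simps)
      ultimately have "apery_a n * \<bar>apery_b n / apery_a n - ?s\<bar> \<le> apery_a n * (zeta 3 / (real n + 1))"
        using apery_a_ge_1[of n] by (simp add: abs_mult)
      moreover have "apery_a n > 0" using apery_a_ge_1[of n] by linarith
      ultimately show "norm (apery_b n / apery_a n - ?s) \<le> zeta 3 / (real n + 1)"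
        by (simp only: mult_le_cancel_left_pos real_norm_def)
    qed
  qed
  moreover have "(\<lambda>n. \<Sum>m=1..n. 1 / real m ^ 3) \<longlonglongrightarrow> zeta 3"
    unfolding shift_partial_sum using zeta_3_sums by (simp add: sums_def)
  ultimately show ?thesis by (rule Lim_transform[rotated])
qed

lemma apery_quotient_step: "apery_b (Suc n) / apery_a (Suc n) - apery_b n / apery_a n
    = 6 / ((real n + 1) ^ 3 * (apery_a n * apery_a (Suc n)))"
proof -
  have "apery_a n > 0" "apery_a (Suc n) > 0" "(real n + 1) ^ 3 > 0"
    using apery_a_ge_1[of n] apery_a_ge_1[of "Suc n"] by (linarith | simp)+
  thus ?thesis using apery_casoratian[of n] by (simp add: field_simps)
qed

lemma apery_a_mono: "n \<le> m \<Longrightarrow> apery_a n \<le> apery_a m"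
  by (rule lift_Suc_mono_le[of apery_a]) (auto intro: apery_a_le_Suc)

lemma apery_remainder_pos: "apery_a n * zeta 3 - apery_b n > 0"
proof -
  let ?x = "\<lambda>n. apery_b n / apery_a n"
  have inc: "?x n < ?x (Suc n)" for n
    using apery_quotient_step[of n] apery_a_ge_1[of n] apery_a_ge_1[of "Suc n"]
    by (smt (verit) divide_pos_pos mult_pos_pos zero_less_power of_nat_0_le_iff)
  have "?x n < ?x (Suc n)" by (rule inc)
  also have "\<dots> \<le> zeta 3"
    by (rule incseq_le[OF _ apery_quotient_tendsto]) (auto intro!: incseq_SucI less_imp_le inc)
  finally show ?thesis using apery_a_ge_1[of n] by (simp add: field_simps)
qed

text \<open>
  The increments \<open>6 / (j\<^sup>3 a\<^sub>j\<^sub>-\<^sub>1 a\<^sub>j)\<close> of the quotients after the index \<open>n\<close> are at most \<open>6 / (j\<^sup>3 a\<^sub>n\<^sup>2)\<close>, so they add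
  up to at most \<open>6 \<zeta>(3) / a\<^sub>n\<^sup>2\<close>.
\<close>

lemma apery_remainder_le: "apery_a n * zeta 3 - apery_b n \<le> 6 * zeta 3 / apery_a n"
proof -
  let ?x = "\<lambda>n. apery_b n / apery_a n" and ?s = "\<lambda>n. \<Sum>m=1..n. 1 / real m ^ 3"
  have pos: "apery_a n > 0" for n using apery_a_ge_1[of n] by linarith
  have bound: "?x (n + m) - ?x n \<le> 6 / apery_a n ^ 2 * (?s (n + m) - ?s n)" for m
  proof (induction m)
    case (Suc m)
    have "6 / ((real (n + m) + 1) ^ 3 * (apery_a (n + m) * apery_a (Suc (n + m))))
        \<le> 6 / ((real (n + m) + 1) ^ 3 * (apery_a n * apery_a n))"
      using pos[of n] pos[of "n + m"] pos[of "Suc (n + m)"]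
      by (intro divide_left_mono mult_left_mono mult_mono apery_a_mono mult_pos_pos zero_less_power) auto
    hence "?x (Suc (n + m)) - ?x (n + m) \<le> 6 / apery_a n ^ 2 * (1 / (real (n + m) + 1) ^ 3)"
      unfolding apery_quotient_step by (simp add: power2_eq_square mult_ac)
    moreover have "?s (Suc (n + m)) = ?s (n + m) + 1 / (real (n + m) + 1) ^ 3" by (simp add: add_ac)
    ultimately show ?case using Suc by (simp only: add_Suc_right right_diff_distrib distrib_left)
  qed simp
  have "?x (n + m) \<le> ?x n + 6 / apery_a n ^ 2 * zeta 3" for m
  proof -
    have "?s (n + m) - ?s n \<le> zeta 3"
      using partial_sum_le_zeta[of "n + m"] sum_nonneg[of "{1..n}" "\<lambda>m. 1 / real m ^ 3"] by simp
    hence "6 / apery_a n ^ 2 * (?s (n + m) - ?s n) \<le> 6 / apery_a n ^ 2 * zeta 3"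
      by (intro mult_left_mono) auto
    thus ?thesis using bound[of m] by linarith
  qed
  hence "zeta 3 \<le> ?x n + 6 / apery_a n ^ 2 * zeta 3"
    by (intro LIMSEQ_le_const2[OF apery_quotient_tendsto]) (metis le_iff_add)
  hence "apery_a n * zeta 3 \<le> apery_a n * (?x n + 6 / apery_a n ^ 2 * zeta 3)"
    using pos[of n] by (intro mult_left_mono) auto
  also have "\<dots> = apery_b n + 6 * zeta 3 / apery_a n" using pos[of n]
    by (simp add: power2_eq_square field_simps)
  finally show ?thesis by linarith
qed

section \<open>Denominators\<close>

text \<open>
  Since \<open>(n + k choose k) (k choose m) = (n + k choose k - m) (n + m choose m)\<close>, the number is an integer
  times the product of \<open>d / m\<close>, \<open>d / (m (n choose m))\<close> and \<open>d / (m (k choose m))\<close> with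
  \<open>d = lcm_upto n\<close>. So each of the three factors \<open>d\<close> clears one denominator.
\<close>

lemma legendre_coeff_quotient_Ints:
  assumes "1 \<le> m" "m \<le> k" "k \<le> n"
  shows "real (lcm_upto n) ^ 3 * real (legendre_coeff n k) / (real m ^ 3 * real (legendre_coeff n m))
      \<in> \<int>"
proof -
  have "((n + k) choose k) * (k choose (k - m)) = ((n + k) choose (k - m)) * ((n + m) choose m)"
    using choose_mult[of "k - m" k "n + k"] assms by simp
  hence "((n + k) choose k) * (k choose m) = ((n + k) choose (k - m)) * ((n + m) choose m)"
    using binomial_symmetric[of m k] assms by simp
  hence eq: "real ((n + k) choose k) * real (k choose m)
      = real ((n + k) choose (k - m)) * real ((n + m) choose m)"
    by (metis of_nat_mult)
  have pos: "real (k choose m) > 0" "real ((n + m) choose m) > 0" "real (n choose m) > 0" "real m > 0"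
    using assms by auto
  have "real (lcm_upto n) ^ 3 * real (legendre_coeff n k) / (real m ^ 3 * real (legendre_coeff n m)) =
    real (n choose k) * real (lcm_upto n) ^ 3 * (real ((n + k) choose k) / real ((n + m) choose m))
        / (real m ^ 3 * real (n choose m))"
    by (simp add: legendre_coeff_def mult_ac)
  also have "real ((n + k) choose k) / real ((n + m) choose m)
      = real ((n + k) choose (k - m)) / real (k choose m)"
    using eq pos by (simp add: field_simps)
  \<comment> \<open>The factor \<open>m choose m = 1\<close> puts \<open>d / m\<close> into the form that \<open>lcm_upto_div_binomial_Ints\<close> treats.\<close>
  also have "real (n choose k) * real (lcm_upto n) ^ 3
      * (real ((n + k) choose (k - m)) / real (k choose m)) / (real m ^ 3 * real (n choose m))
    = real (n choose k) * real ((n + k) choose (k - m))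
        * ((real (lcm_upto n) / (real m * real (m choose m)))
      * (real (lcm_upto n) / (real m * real (n choose m)))
          * (real (lcm_upto n) / (real m * real (k choose m))))"
    by (simp add: power3_eq_cube mult_ac)
  also have "\<dots> \<in> \<int>"
    using assms by (intro Ints_mult Ints_of_nat lcm_upto_div_binomial_Ints) auto
  finally show ?thesis .
qed

text \<open>
  Only one of the two factors \<open>legendre_coeff n k\<close> of a summand is used to clear the denominators of
  \<open>apery_c n k\<close>; the factor \<open>2\<close> is the one in its definition.
\<close>

lemma apery_b_denominator: "2 * real (lcm_upto n) ^ 3 * apery_b n \<in> \<int>"
proof -
  have "2 * real (lcm_upto n) ^ 3 * real (legendre_coeff n k) * apery_c n k \<in> \<int>" if k: "k \<le> n" for k
  proof -
    have "2 * real (lcm_upto n) ^ 3 * real (legendre_coeff n k) * apery_c n k =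
      2 * real (legendre_coeff n k)
          * (\<Sum>m=1..n. (real (lcm_upto n) / (real m * real (m choose m))) ^ 3)
      + (\<Sum>m=1..k. (-1) ^ (m + 1)
          * (real (lcm_upto n) ^ 3 * real (legendre_coeff n k)
          / (real m ^ 3 * real (legendre_coeff n m))))"
      unfolding apery_c_def distrib_left by (simp add: sum_distrib_left power_divide mult_ac)
    also have "\<dots> \<in> \<int>"
      using k by (intro Ints_add Ints_mult Ints_sum Ints_power legendre_coeff_quotient_Ints lcm_upto_div_binomial_Ints) auto
    finally show ?thesis .
  qed
  hence "(\<Sum>k\<le>n. real (legendre_coeff n k)
      * (2 * real (lcm_upto n) ^ 3 * real (legendre_coeff n k) * apery_c n k)) \<in> \<int>"
    by (intro Ints_sum Ints_mult[OF Ints_of_nat]) auto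
  also have "(\<Sum>k\<le>n. real (legendre_coeff n k)
      * (2 * real (lcm_upto n) ^ 3 * real (legendre_coeff n k) * apery_c n k))
      = 2 * real (lcm_upto n) ^ 3 * apery_b n"
    by (simp add: apery_b_def sum_distrib_left power2_eq_square mult_ac)
  finally show ?thesis .
qed

lemma apery_a_Ints: "apery_a n \<in> \<int>" unfolding apery_a_def by auto


section \<open>Irrationality\<close>

theorem theorem2:
  shows "(\<lambda>n. 1 / real (Suc n) ^ 3) sums zeta 3 \<and> zeta 3 \<notin> \<rat>"
proof (rule conjI[OF zeta_3_sums], rule notI)
  assume "zeta 3 \<in> \<rat>"
  then obtain p q :: int where pq: "q > 0" "zeta 3 = of_int p / of_int q"
    by (rule Rats_cases')
  obtain C where C: "C > 0" "\<And>n. real (lcm_upto n) \<le> C * (31 / 10) ^ n" using lcm_upto_bound by blast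
  \<comment> \<open>A positive integer for each \<open>n\<close>, if \<open>\<zeta>(3) = p / q\<close>.\<close>
  define r where "r n = 2 * of_int q * real (lcm_upto n) ^ 3 * (apery_a n * zeta 3 - apery_b n)" for n
  have r_ge: "r n \<ge> 1" for n
  proof -
    have "r n = 2 * real (lcm_upto n) ^ 3 * apery_a n * of_int p
        - of_int q * (2 * real (lcm_upto n) ^ 3 * apery_b n)"
      using pq by (simp add: r_def field_simps)
    also have "\<dots> \<in> \<int>"
      by (intro Ints_diff Ints_mult[OF _ apery_b_denominator] Ints_mult[OF Ints_mult[OF _ apery_a_Ints]]) auto
    finally have "r n \<in> \<int>" .
    moreover have "r n > 0"
      unfolding r_def using pq lcm_upto_pos[of n] apery_remainder_pos[of n] by simp
    ultimately show ?thesis by (auto elim!: Ints_cases)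
  qed
  define K where "K = 2 * of_int q * (6 * zeta 3) * C ^ 3 * ((31 / 10) ^ 3) ^ 48"
  have r_le: "r (48 + n) \<le> K * ((31 / 10) ^ 3 / 32) ^ n" for n
  proof -
    have "r (48 + n) \<le> 2 * of_int q * (C * (31 / 10) ^ (48 + n)) ^ 3 * (6 * zeta 3 / 32 ^ n)"
      unfolding r_def
    proof (rule mult_mono)
      have "6 * zeta 3 / apery_a (48 + n) \<le> 6 * zeta 3 / 32 ^ n"
        using apery_a_ge_power[of n] apery_a_ge_1[of "48 + n"] zeta_3_pos
          by (intro divide_left_mono) auto
      thus "apery_a (48 + n) * zeta 3 - apery_b (48 + n) \<le> 6 * zeta 3 / 32 ^ n"
        using apery_remainder_le[of "48 + n"] by linarith
      show "2 * of_int q * real (lcm_upto (48 + n)) ^ 3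
          \<le> 2 * of_int q * (C * (31 / 10) ^ (48 + n)) ^ 3"
        using pq C(2)[of "48 + n"] by (intro mult_left_mono power_mono) auto
    qed (use pq C apery_remainder_pos[of "48 + n"] in auto)
    also have "(C * (31 / 10) ^ (48 + n)) ^ 3 = C ^ 3 * ((31 / 10) ^ 3) ^ 48 * ((31 / 10) ^ 3) ^ n"
      unfolding power_mult_distrib power_commutes[symmetric] power_add power_mult[symmetric] mult.assoc
      by (simp only: mult.commute)
    also have "2 * of_int q * (C ^ 3 * ((31 / 10) ^ 3) ^ 48 * ((31 / 10) ^ 3) ^ n)
        * (6 * zeta 3 / 32 ^ n)
        = K * ((31 / 10) ^ 3 / 32) ^ n"
      unfolding K_def power_divide[of "(31 / 10) ^ 3"]
      by (simp only: times_divide_eq_right times_divide_eq_left mult_ac)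
    finally show ?thesis .
  qed
  have "(\<lambda>n. ((31 / 10) ^ 3 / 32 :: real) ^ n) \<longlonglongrightarrow> 0"
    by (rule LIMSEQ_realpow_zero) (auto simp: divide_simps)
  hence "(\<lambda>n. K * ((31 / 10) ^ 3 / 32) ^ n) \<longlonglongrightarrow> K * 0" by (intro tendsto_mult tendsto_const)
  moreover have "\<exists>N. \<forall>n\<ge>N. 1 \<le> K * ((31 / 10) ^ 3 / 32) ^ n"
    using r_ge r_le order_trans by blast
  ultimately have "1 \<le> K * 0" by (rule LIMSEQ_le_const)
  thus False by simp
qed

end
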